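(* Let $A\in\mathbb{R}^{m\times n}$, $m\ge n$, have full column rank, let $\mathbf{b}\in\mathbb{R}^m$, and let $W\in\mathbb{R}^{m\times m}$ be symmetric positive definite. Put $A_{W,I_n}^{\dagger}=(A^{\mathrm T}WA)^{-1}A^{\mathrm T}W$, and let $(\mathbf{d},\mathbf{x})$ be the solution of the augmented system $$\begin{bmatrix} W^{-1} & A \\ {} A^{\mathrm T} & 0 \end{bmatrix}\begin{bmatrix} \mathbf{d} \\ {} \mathbf{x} \end{bmatrix}=\begin{bmatrix} \mathbf{b} \\ {} \mathbf{0} \end{bmatrix}.$$ Let $\epsilon>0$ satisfy $$\epsilon<\rho^{-1}\left(\begin{bmatrix} |(A_{W,I_n}^{\dagger})^{\mathrm T}|\,|A|^{\mathrm T} & |W-(A_{W,I_n}^{\dagger})^{\mathrm T}A^{\mathrm T}W|\,|A| \\ {} |(A^{\mathrm T}WA)^{-1}|\,|A|^{\mathrm T} & |A_{W,I_n}^{\dagger}|\,|A| \end{bmatrix}\right),$$ and let $\Delta A\in\mathbb{R}^{m\times n}$, $\Delta\mathbf{b}\in\mathbb{R}^m$ satisfy the componentwise bounds $|\Delta A|\le\epsilon|A|$ and $|\Delta\mathbf{b}|\le\epsilon|\mathbf{b}|$. Let $(\mathbf{d}+\Delta\mathbf{d},\mathbf{x}+\Delta\mathbf{x})$ be the solution of the perturbed system $$\begin{bmatrix} W^{-1} & A+\Delta A \\ {} (A+\Delta A)^{\mathrm T} & 0 \end{bmatrix}\begin{bmatrix} \mathbf{d}+\Delta\mathbf{d} \\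 {} \mathbf{x}+\Delta\mathbf{x} \end{bmatrix}=\begin{bmatrix} \mathbf{b}+\Delta\mathbf{b} \\ {} \mathbf{0} \end{bmatrix}.$$ Then the error in the solution is bounded by $$\|\Delta\mathbf{x}\|_\infty\le\epsilon\Big(\big\||A_{W,I_n}^{\dagger}|(|\mathbf{b}|+|A|\,|\mathbf{x}|)\big\|_\infty+\big\||(A^{\mathrm T}WA)^{-1}|\,|A|^{\mathrm T}|\mathbf{d}|\big\|_\infty\Big)+O(\epsilon^2)$$ and the error in the weighted residual is bounded by $$\|\Delta\mathbf{d}\|_\infty\le\epsilon\Big(\big\||W-(A_{W,I_n}^{\dagger})^{\mathrm T}A^{\mathrm T}W|(|\mathbf{b}|+|A|\,|\mathbf{x}|)\big\|_\infty+\big\||(A_{W,I_n}^{\dagger})^{\mathrm T}|\,|A|^{\mathrm T}|\mathbf{d}|\big\|_\infty\Big)+O(\epsilon^2).$$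
   Context: $|\cdot|$ applied to matrices and vectors is the entrywise absolute value, and inequalities between matrices or vectors are entrywise. $\rho(M)$ is the spectral radius of the square matrix $M$ and $\rho^{-1}(M)=1/\rho(M)$. Here $\mathbf{x}$ is the weighted least squares solution, the minimizer of $(A\mathbf{x}-\mathbf{b})^{\mathrm T}W(A\mathbf{x}-\mathbf{b})$, and $\mathbf{d}=W(\mathbf{b}-A\mathbf{x})$ is the weighted residual. The condition on $\epsilon$ guarantees that the perturbed augmented matrix is invertible. The $O(\epsilon^2)$ terms are understood as $\epsilon\to0$ with $A,\mathbf{b},W$ fixed, with constants depending only on $A,\mathbf{b},W$. *)

theory Defs
  imports "HOL-Analysis.Analysis" "HOL-Library.Landau_Symbols"
begin

text \<open>
  Entrywise absolute values and entrywise inequalities of vectors and matrices are the library's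
  lattice operations on \<^typ>\<open>real^'n\<close> and \<^typ>\<open>real^'n^'m\<close>; the maximum norm is \<^const>\<open>infnorm\<close>.
\<close>

text \<open>Block indices are sums: \<^const>\<open>Inl\<close> is the upper (left) block, \<^const>\<open>Inr\<close> the lower (right) one.\<close>

definition block_vector :: "'a^'p \<Rightarrow> 'a^'q \<Rightarrow> 'a^('p + 'q)" where
  "block_vector u v = (\<chi> i. case i of Inl p \<Rightarrow> u $ p | Inr q \<Rightarrow> v $ q)"

definition block_matrix ::
  "'a^'r^'p \<Rightarrow> 'a^'s^'p \<Rightarrow> 'a^'r^'q \<Rightarrow> 'a^'s^'q \<Rightarrow> 'a^('r + 's)^('p + 'q)" where
  "block_matrix M11 M12 M21 M22 =
     (\<chi> i. case i of Inl p \<Rightarrow> block_vector (M11 $ p) (M12 $ p)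
                   | Inr q \<Rightarrow> block_vector (M21 $ q) (M22 $ q))"

text \<open>The spectrum is that of the complexified matrix, so non-real eigenvalues count.\<close>

definition mat_spectral_radius :: "real^'k^'k \<Rightarrow> real" where
  "mat_spectral_radius M =
     Max {cmod z | z. \<exists>v::complex^'k. v \<noteq> 0 \<and> map_matrix complex_of_real M *v v = z *s v}"

definition sym_pos_def :: "real^'k^'k \<Rightarrow> bool" where
  "sym_pos_def W \<longleftrightarrow> transpose W = W \<and> (\<forall>v. v \<noteq> 0 \<longrightarrow> v \<bullet> (W *v v) > 0)"

definition weighted_pinv :: "real^'m^'m \<Rightarrow> real^'n^'m \<Rightarrow> real^'m^'n" where
  "weighted_pinv W A = matrix_inv (transpose A ** W ** A) ** transpose A ** W"

definition augmented_matrix :: "real^'m^'m \<Rightarrow> real^'n^'m \<Rightarrow> real^('m + 'n)^('m + 'n)" where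
  "augmented_matrix W A = block_matrix (matrix_inv W) A (transpose A) 0"

text \<open>
  The matrix whose reciprocal spectral radius limits the size of the perturbation. If \<open>A\<close> has full
  column rank then \<open>weighted_pinv W A ** A\<close> is the identity, whence the spectral radius is at least
  1 and its reciprocal is never a division by zero.
\<close>

definition perturbation_matrix :: "real^'m^'m \<Rightarrow> real^'n^'m \<Rightarrow> real^('m + 'n)^('m + 'n)" where
  "perturbation_matrix W A =
     block_matrix
       (\<bar>transpose (weighted_pinv W A)\<bar> ** transpose \<bar>A\<bar>)
       (\<bar>W - transpose (weighted_pinv W A) ** transpose A ** W\<bar> ** \<bar>A\<bar>)
       (\<bar>matrix_inv (transpose A ** W ** A)\<bar> ** transpose \<bar>A\<bar>)
       (\<bar>weighted_pinv W A\<bar> ** \<bar>A\<bar>)"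

end

theory Submission
  imports Defs
begin

text \<open>
  Subtracting the two augmented systems shows that \<open>(\<Delta>d, \<Delta>x)\<close> solves the unperturbed system with
  the right-hand side \<open>(\<Delta>b - \<Delta>A (x + \<Delta>x), - \<Delta>A\<^sup>T (d + \<Delta>d))\<close>. Inverting the augmented
  matrix in blocks and taking absolute values, with \<open>\<epsilon> |A|\<close> and \<open>\<epsilon> |b|\<close> in place of \<open>|\<Delta>A|\<close> and
  \<open>|\<Delta>b|\<close>, gives for \<open>z = (|\<Delta>d|, |\<Delta>x|)\<close> the implicit componentwise inequality

    \<open>z \<le> \<epsilon> (g + M z)\<close>,

  where \<open>g\<close> holds the two first-order bounds of the theorem and \<open>M\<close> is the nonnegative matrix
  \<^const>\<open>perturbation_matrix\<close> (lemma \<open>perturbation_inequality\<close>). It remains to see that \<open>\<epsilon> M z\<close> is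
  of second order.

  If \<open>\<epsilon> \<rho>(M) < 1\<close>, then the inequality bounds \<open>z\<close> from above, uniformly in the perturbation
  (lemma \<open>subsolutions_bounded\<close>). The spectral radius enters only through the fact that
  \<open>I - t \<epsilon> M\<close> is nonsingular for all \<open>t\<close> in \<open>[0,1]\<close>. From this a strictly positive vector \<open>u\<close> with
  \<open>u = f + \<epsilon> M u\<close> is found by continuation in \<open>t\<close>, for any strictly positive \<open>f\<close>: the solution of
  \<open>u = f + t \<epsilon> M u\<close> is positive at \<open>t = 0\<close>, depends continuously on \<open>t\<close>, and cannot reach the
  boundary of the positive cone, because a nonnegative solution is at least \<open>f\<close>
  (lemma \<open>positive_fixed_point\<close>). Such a \<open>u\<close> dominates every \<open>z \<le> f + \<epsilon> M z\<close>
  (lemma \<open>subsolution_le_positive_fixed_point\<close>), a maximum principle that replaces the Neumann series.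

  Applied to \<open>z / \<epsilon>\<close>, the boundedness gives \<open>z \<le> \<epsilon> u\<close> with one \<open>u\<close> for all \<open>\<epsilon>\<close> up to a given
  \<open>\<epsilon>\<^sub>0 < 1 / \<rho>(M)\<close>, so \<open>z \<le> \<epsilon> g + \<epsilon>\<^sup>2 M u\<close> (lemma \<open>second_order_bound\<close>). Maximum norms
  of the two blocks give the theorem.
\<close>

section \<open>Nonnegative matrices and the entrywise order\<close>

lemma abs_matrix_nth [simp]: "\<bar>M\<bar> $ i $ j = \<bar>M $ i $ j\<bar>" for M :: "real^'n^'m"
  by (simp add: abs_vec_def)

lemma abs_vector_nth [simp]: "\<bar>v\<bar> $ i = \<bar>v $ i\<bar>" for v :: "real^'n"
  by (simp add: abs_vec_def)

lemma transpose_abs: "transpose \<bar>M\<bar> = \<bar>transpose M\<bar>" for M :: "real^'n^'m"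
  by (simp add: vec_eq_iff transpose_def)

lemma matrix_vector_mono:
  fixes M :: "real^'n^'m"
  assumes "0 \<le> M" "v \<le> w"
  shows "M *v v \<le> M *v w"
  using assms by (auto simp: less_eq_vec_def matrix_vector_mult_def intro!: sum_mono mult_left_mono)

lemma matrix_vector_mono_left:
  fixes M N :: "real^'n^'m"
  assumes "M \<le> N" "0 \<le> v"
  shows "M *v v \<le> N *v v"
  using assms by (auto simp: less_eq_vec_def matrix_vector_mult_def intro!: sum_mono mult_right_mono)

lemma abs_matrix_vector_le: "\<bar>M *v v\<bar> \<le> \<bar>M\<bar> *v \<bar>v\<bar>" for M :: "real^'n^'m"
  by (auto simp: less_eq_vec_def matrix_vector_mult_def abs_mult[symmetric])

lemma abs_matrix_vector_bound:
  fixes M :: "real^'n^'m"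
  assumes "\<bar>v\<bar> \<le> w"
  shows "\<bar>M *v v\<bar> \<le> \<bar>M\<bar> *v w"
  using abs_matrix_vector_le[of M v] matrix_vector_mono[OF abs_ge_zero assms, of M] by (rule order_trans)

lemma matrix_mult_nonneg:
  fixes M :: "real^'n^'m" and N :: "real^'k^'n"
  assumes "0 \<le> M" "0 \<le> N"
  shows "0 \<le> M ** N"
  using assms by (auto simp: less_eq_vec_def matrix_matrix_mult_def intro!: sum_nonneg mult_nonneg_nonneg)

lemma infnorm_le_iff: "infnorm v \<le> c \<longleftrightarrow> (\<forall>i. \<bar>v $ i\<bar> \<le> c)" for v :: "real^'n"
proof
  assume "\<forall>i. \<bar>v $ i\<bar> \<le> c"
  then show "infnorm v \<le> c"
    unfolding infnorm_cart by (intro cSup_least) auto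
qed (use component_le_infnorm_cart order_trans in blast)

lemma infnorm_mono_abs:
  fixes v w :: "real^'n"
  assumes "\<bar>v\<bar> \<le> w"
  shows "infnorm v \<le> infnorm w"
  unfolding infnorm_le_iff
proof
  fix i
  have "\<bar>v $ i\<bar> \<le> w $ i" using assms by (simp add: less_eq_vec_def)
  also have "\<dots> \<le> infnorm w" using component_le_infnorm_cart[of w i] by simp
  finally show "\<bar>v $ i\<bar> \<le> infnorm w" .
qed

section \<open>Spectral radius and nonsingularity\<close>

lemma poly_det: "poly (det Q) z = det (\<chi> i j. poly (Q $ i $ j) z)"
  for Q :: "'a::comm_ring_1 poly^'n^'n"
  unfolding det_def by (simp add: poly_sum poly_prod)

text \<open>
  Nonzero eigenvalues are the reciprocals of the roots of the polynomial \<open>det (I - w M)\<close> in \<open>w\<close>,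
  which is not the zero polynomial because its value at \<open>w = 0\<close> is 1. Finiteness matters because
  \<^const>\<open>Max\<close> in the definition of the spectral radius is meaningful for finite sets only.
\<close>

lemma finite_eigenvalues:
  fixes M :: "'a::{field_char_0}^'n^'n"
  shows "finite {z. \<exists>v. v \<noteq> 0 \<and> M *v v = z *s v}"
proof -
  define Q :: "'a poly^'n^'n" where "Q = (\<chi> i j. [:if i = j then 1 else 0, - (M $ i $ j):])"
  define R where "R w = (\<chi> i j. w * M $ i $ j)" for w
  have Q_eval: "poly (det Q) w = det (mat 1 - R w)" for w
    unfolding poly_det by (rule arg_cong[of _ _ det]) (simp add: Q_def R_def vec_eq_iff mat_def)
  have "R 0 = 0" by (simp add: R_def vec_eq_iff)
  then have "poly (det Q) 0 = 1" by (simp add: Q_eval)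
  then have "det Q \<noteq> 0" by auto
  then have fin: "finite (insert 0 (inverse ` {w. poly (det Q) w = 0}))"
    by (simp add: poly_roots_finite)
  have root: "poly (det Q) (inverse z) = 0" if "z \<noteq> 0" "v \<noteq> 0" "M *v v = z *s v" for z v
  proof -
    have "R (inverse z) *v v = inverse z *s (M *v v)"
      by (simp add: R_def vec_eq_iff matrix_vector_mult_def sum_distrib_left mult.assoc)
    with that have "(mat 1 - R (inverse z)) *v v = 0"
      by (simp add: matrix_vector_mult_diff_rdistrib vec_eq_iff)
    with \<open>v \<noteq> 0\<close> have "\<not> invertible (mat 1 - R (inverse z))"
      using matrix_left_invertible_ker[of "mat 1 - R (inverse z)"] by (auto simp: invertible_left_inverse)
    then show ?thesis by (simp add: Q_eval invertible_det_nz)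
  qed
  then have "{z. \<exists>v. v \<noteq> 0 \<and> M *v v = z *s v} \<subseteq> insert 0 (inverse ` {w. poly (det Q) w = 0})"
  proof clarify
    fix z v assume z: "z \<notin> inverse ` {w. poly (det Q) w = 0}" "v \<noteq> 0" "M *v v = z *s v"
    show "z = 0"
    proof (rule ccontr)
      assume "z \<noteq> 0"
      then have "z = inverse (inverse z)" "poly (det Q) (inverse z) = 0"
        using root z by auto
      with z(1) show False by blast
    qed
  qed
  with fin show ?thesis by (rule rev_finite_subset)
qed

lemma real_eigenvalue_le_spectral_radius:
  fixes M :: "real^'n^'n"
  assumes "v \<noteq> 0" "M *v v = z *\<^sub>R v"
  shows "z \<le> mat_spectral_radius M"
proof -
  let ?E = "{z. \<exists>v::complex^'n. v \<noteq> 0 \<and> map_matrix complex_of_real M *v v = z *s v}"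
  have "(\<Sum>j\<in>UNIV. M $ i $ j * v $ j) = z * v $ i" for i
    using assms(2) by (simp add: vec_eq_iff matrix_vector_mult_def)
  then have "(\<Sum>j\<in>UNIV. complex_of_real (M $ i $ j) * complex_of_real (v $ j))
      = complex_of_real z * complex_of_real (v $ i)" for i
    by (metis (mono_tags, lifting) of_real_mult of_real_sum sum.cong)
  then have "map_matrix complex_of_real M *v (\<chi> i. of_real (v $ i)) = of_real z *s (\<chi> i. of_real (v $ i))"
    by (simp add: vec_eq_iff matrix_vector_mult_def map_matrix_def)
  moreover have "(\<chi> i. complex_of_real (v $ i)) \<noteq> 0"
    using assms(1) by (simp add: vec_eq_iff)
  ultimately have "complex_of_real z \<in> ?E" by blast
  then have "cmod (complex_of_real z) \<in> cmod ` ?E" by (rule imageI)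
  also have "cmod ` ?E = {cmod z | z. \<exists>v::complex^'n. v \<noteq> 0 \<and> map_matrix complex_of_real M *v v = z *s v}"
    by blast
  finally have "cmod (complex_of_real z) \<le> mat_spectral_radius M"
    unfolding mat_spectral_radius_def
    using finite_imageI[OF finite_eigenvalues[of "map_matrix complex_of_real M"], of cmod]
    by (intro Max_ge) (simp_all add: setcompr_eq_image)
  then show ?thesis by simp
qed

text \<open>
  A kernel vector for \<open>t > 0\<close> would be an eigenvector of \<open>M\<close> for the real eigenvalue \<open>1 / t\<close>,
  which exceeds the spectral radius; for \<open>t = 0\<close> the matrix is the identity.
\<close>

lemma det_below_reciprocal_spectral_radius:
  fixes M :: "real^'n^'n"
  assumes "0 \<le> t" "t < 1 / mat_spectral_radius M"
  shows "det (mat 1 - t *\<^sub>R M) \<noteq> 0"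
proof
  assume "det (mat 1 - t *\<^sub>R M) = 0"
  then obtain v where v: "v \<noteq> 0" "(mat 1 - t *\<^sub>R M) *v v = 0"
    using matrix_left_invertible_ker[of "mat 1 - t *\<^sub>R M"]
      invertible_left_inverse[of "mat 1 - t *\<^sub>R M"] invertible_det_nz[of "mat 1 - t *\<^sub>R M"]
    by blast
  then have fixed: "v = t *\<^sub>R (M *v v)"
    by (simp add: matrix_vector_mult_diff_rdistrib scaleR_matrix_vector_assoc)
  with v have "t \<noteq> 0" by auto
  with assms have t: "0 < t" by simp
  have "M *v v = (1 / t) *\<^sub>R v"
    using fixed \<open>t \<noteq> 0\<close> by (metis divide_self_if scaleR_one scaleR_scaleR times_divide_eq_left mult_1)
  with v have "1 / t \<le> mat_spectral_radius M"
    by (intro real_eigenvalue_le_spectral_radius)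
  moreover from this t have "0 < mat_spectral_radius M"
    by (smt (verit) divide_pos_pos)
  ultimately show False using assms t by (simp add: field_simps)
qed

section \<open>Positive fixed points bound subsolutions\<close>

lemma continuous_on_det:
  fixes F :: "'a::topological_space \<Rightarrow> real^'n^'n"
  assumes "\<And>i j. continuous_on S (\<lambda>t. F t $ i $ j)"
  shows "continuous_on S (\<lambda>t. det (F t))"
  unfolding det_def by (intro continuous_intros assms)

text \<open>
  Continuation from \<open>t = 0\<close> to \<open>t = 1\<close> in \<open>u(t) = f + t T u(t)\<close>. The parameters \<open>t\<close> with
  \<open>u(t)\<close> strictly positive form an open set; they also form a closed set, because \<open>u(t) \<ge> 0\<close>
  already forces \<open>u(t) \<ge> f > 0\<close>. Connectedness of the interval does the rest.
\<close>

lemma positive_fixed_point: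
  fixes T :: "real^'n^'n" and f :: "real^'n"
  assumes T: "0 \<le> T" and f: "\<And>i. 0 < f $ i"
    and det: "\<And>t. 0 \<le> t \<Longrightarrow> t \<le> 1 \<Longrightarrow> det (mat 1 - t *\<^sub>R T) \<noteq> 0"
  obtains u where "\<And>i. 0 < u $ i" "u = f + T *v u"
proof -
  \<comment> \<open>Cramer's rule makes the continuity of the solution in \<open>t\<close> visible.\<close>
  define u where "u t = (\<chi> k. det (\<chi> i j. if j = k then f $ i else (mat 1 - t *\<^sub>R T) $ i $ j)
    / det (mat 1 - t *\<^sub>R T))" for t
  have eq: "u t = f + t *\<^sub>R (T *v u t)" if "t \<in> {0..1}" for t
    using cramer[OF det, of t "u t" f] that
    by (simp add: u_def[symmetric] matrix_vector_mult_diff_rdistrib scaleR_matrix_vector_assoc algebra_simps)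
  have cont: "continuous_on {0..1} (\<lambda>t. u t $ k)" for k
    unfolding u_def vec_lambda_beta
  proof (intro continuous_on_divide continuous_on_det)
    show "continuous_on {0..1} (\<lambda>t. (\<chi> i j. if j = k then f $ i else (mat 1 - t *\<^sub>R T) $ i $ j) $ i $ j)"
      for i j by (cases "j = k") (auto intro!: continuous_intros)
  qed (use det in \<open>auto intro!: continuous_intros\<close>)
  define P where "P = {t \<in> {0..1}. \<forall>i. 0 < u t $ i}"
  have P_closed_form: "P = {t \<in> {0..1}. \<forall>i. 0 \<le> u t $ i}"
  proof -
    have "0 < u t $ i" if t: "t \<in> {0..1}" and nonneg: "\<forall>i. 0 \<le> u t $ i" for t i
    proof -
      have "0 \<le> T *v u t"
        using matrix_vector_mono[OF T, of 0 "u t"] nonneg by (simp add: less_eq_vec_def)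
      then have "f $ i \<le> (f + t *\<^sub>R (T *v u t)) $ i"
        using t by (simp add: less_eq_vec_def)
      with f[of i] eq[OF t] show ?thesis by simp
    qed
    then show ?thesis by (auto simp: P_def intro: less_imp_le)
  qed
  have "openin (top_of_set {0..1}) P"
  proof -
    have "P = {0..1} \<inter> (\<Inter>i. {0..1} \<inter> (\<lambda>t. u t $ i) -` {0<..})"
      by (auto simp: P_def)
    moreover have "openin (top_of_set {0..1}) (\<Inter>i. {0..1} \<inter> (\<lambda>t. u t $ i) -` {0<..})"
      by (intro openin_Inter) (auto intro!: continuous_openin_preimage_gen cont)
    ultimately show ?thesis by (simp add: openin_Int)
  qed
  moreover have "closedin (top_of_set {0..1}) P"
  proof -
    have "P = (\<Inter>i. {0..1} \<inter> (\<lambda>t. u t $ i) -` {0..})"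
      by (auto simp: P_closed_form)
    moreover have "closedin (top_of_set {0..1}) (\<Inter>i. {0..1} \<inter> (\<lambda>t. u t $ i) -` {0..})"
      by (intro closedin_Inter) (auto intro!: continuous_closedin_preimage cont)
    ultimately show ?thesis by simp
  qed
  moreover have "0 \<in> P" using f eq[of 0] by (simp add: P_def)
  ultimately have "P = {0..1}"
    using connected_clopen[of "{0..1::real}"] by auto
  then have "1 \<in> P" by simp
  with that[of "u 1"] eq[of 1] show ?thesis by (simp add: P_def)
qed

text \<open>
  A maximum principle. Let \<open>c\<close> be the least number with \<open>z - u \<le> c u\<close>, attained in
  component \<open>i\<close>. If \<open>c\<close> were positive, then \<open>z - u \<le> T (z - u) \<le> c T u\<close>, and \<open>T u < u\<close>
  strictly because \<open>f\<close> is positive, so component \<open>i\<close> would be less than \<open>c u\<close> there.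
\<close>

lemma subsolution_le_positive_fixed_point:
  fixes T :: "real^'n^'n" and f u z :: "real^'n"
  assumes T: "0 \<le> T" and f: "\<And>i. 0 < f $ i" and u: "\<And>i. 0 < u $ i" "u = f + T *v u"
    and z: "z \<le> f + T *v z"
  shows "z \<le> u"
proof -
  define q where "q j = (z - u) $ j / u $ j" for j
  have "Max (range q) \<in> range q" by (rule Max_in) auto
  then obtain i where "q i = Max (range q)" by (metis imageE)
  then have i: "(z - u) $ j / u $ j \<le> (z - u) $ i / u $ i" for j
    using Max_ge[of "range q" "q j"] by (simp add: q_def)
  define c where "c = (z - u) $ i / u $ i"
  have le: "z - u \<le> c *\<^sub>R u"
    using i u(1) by (simp add: less_eq_vec_def c_def divide_le_eq)
  have "c \<le> 0"
  proof (rule ccontr)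
    assume "\<not> c \<le> 0"
    have "z - u \<le> T *v (z - u)"
      using z u(2) by (simp add: matrix_vector_mult_diff_distrib less_eq_vec_def)
        (smt (verit) vector_add_component)
    also have "\<dots> \<le> T *v (c *\<^sub>R u)"
      by (rule matrix_vector_mono[OF T le])
    finally have "(z - u) $ i \<le> c * (T *v u) $ i"
      by (simp add: less_eq_vec_def matrix_vector_mult_scaleR)
    also have "(T *v u) $ i < u $ i"
      using f[of i] arg_cong[OF u(2), of "\<lambda>v. v $ i"] by simp
    then have "c * (T *v u) $ i < c * u $ i" using \<open>\<not> c \<le> 0\<close> by simp
    finally show False using u(1)[of i] by (simp add: c_def)
  qed
  show ?thesis
    unfolding less_eq_vec_def
  proof
    fix j
    have "(z - u) $ j \<le> c * u $ j" using le by (simp add: less_eq_vec_def)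
    also have "\<dots> \<le> 0" using \<open>c \<le> 0\<close> u(1)[of j] by (simp add: mult_nonpos_nonneg less_imp_le)
    finally show "z $ j \<le> u $ j" by simp
  qed
qed

text \<open>
  Here \<open>g\<close> may have components that vanish or are negative; enlarging it to a strictly positive \<open>f\<close>
  makes the two preceding lemmas applicable.
\<close>

lemma subsolutions_bounded:
  fixes M :: "real^'n^'n" and g :: "real^'n"
  assumes "0 \<le> M" "0 \<le> \<epsilon>" "\<epsilon> < 1 / mat_spectral_radius M"
  obtains u where "\<And>z. z \<le> g + \<epsilon> *\<^sub>R (M *v z) \<Longrightarrow> z \<le> u"
proof -
  define f where "f = (\<chi> i. \<bar>g $ i\<bar> + 1)"
  have T: "0 \<le> \<epsilon> *\<^sub>R M" using assms by (simp add: scaleR_nonneg_nonneg)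
  have det: "det (mat 1 - t *\<^sub>R (\<epsilon> *\<^sub>R M)) \<noteq> 0" if "0 \<le> t" "t \<le> 1" for t
    using det_below_reciprocal_spectral_radius[of "t * \<epsilon>" M] that assms mult_right_mono[of t 1 \<epsilon>] by simp
  have f: "0 < f $ i" for i by (simp add: f_def)
  obtain u where u: "\<And>i. 0 < u $ i" "u = f + (\<epsilon> *\<^sub>R M) *v u"
    using positive_fixed_point[OF T f det] by blast
  have "g \<le> f" by (auto simp: less_eq_vec_def f_def)
  have "z \<le> u" if "z \<le> g + \<epsilon> *\<^sub>R (M *v z)" for z
  proof (rule subsolution_le_positive_fixed_point[OF T f u])
    have "z \<le> g + (\<epsilon> *\<^sub>R M) *v z" using that by (simp add: scaleR_matrix_vector_assoc)
    also have "\<dots> \<le> f + (\<epsilon> *\<^sub>R M) *v z" using \<open>g \<le> f\<close> by (rule add_right_mono)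
    finally show "z \<le> f + (\<epsilon> *\<^sub>R M) *v z" .
  qed
  with that show ?thesis by blast
qed

section \<open>Solving the augmented system\<close>

lemma block_matrix_vector_mult:
  fixes M11 :: "'a::semiring_1^'r^'p" and M22 :: "'a^'s^'q"
  shows "block_matrix M11 M12 M21 M22 *v block_vector u v
    = block_vector (M11 *v u + M12 *v v) (M21 *v u + M22 *v v)"
proof -
  have sum_UNIV: "(\<Sum>i\<in>UNIV. h i) = (\<Sum>i\<in>UNIV. h (Inl i)) + (\<Sum>i\<in>UNIV. h (Inr i))"
    for h :: "'r + 's \<Rightarrow> 'a"
    by (subst UNIV_Plus_UNIV[symmetric], subst sum.Plus) simp_all
  show ?thesis
    by (auto simp: vec_eq_iff block_matrix_def block_vector_def matrix_vector_mult_def sum_UNIV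
        split: sum.split)
qed

lemma block_vector_eq_iff: "block_vector u v = block_vector u' v' \<longleftrightarrow> u = u' \<and> v = v'"
proof
  assume eq: "block_vector u v = block_vector u' v'"
  have "u $ p = u' $ p" for p
    using arg_cong[OF eq, of "\<lambda>w. w $ Inl p"] by (simp add: block_vector_def)
  moreover have "v $ q = v' $ q" for q
    using arg_cong[OF eq, of "\<lambda>w. w $ Inr q"] by (simp add: block_vector_def)
  ultimately show "u = u' \<and> v = v'" by (simp add: vec_eq_iff)
qed simp

lemma block_vector_le_iff: "block_vector u v \<le> block_vector u' v' \<longleftrightarrow> u \<le> u' \<and> v \<le> v'"
  for u u' :: "real^'p" and v v' :: "real^'q"
proof
  assume le: "block_vector u v \<le> block_vector u' v'"
  have "u $ p \<le> u' $ p" for p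
    using le[unfolded less_eq_vec_def, rule_format, of "Inl p"] by (simp add: block_vector_def)
  moreover have "v $ q \<le> v' $ q" for q
    using le[unfolded less_eq_vec_def, rule_format, of "Inr q"] by (simp add: block_vector_def)
  ultimately show "u \<le> u' \<and> v \<le> v'" by (simp add: less_eq_vec_def)
qed (auto simp: less_eq_vec_def block_vector_def split: sum.split)

lemma block_matrix_nonneg:
  fixes M11 :: "real^'r^'p" and M22 :: "real^'s^'q"
  assumes "0 \<le> M11" "0 \<le> M12" "0 \<le> M21" "0 \<le> M22"
  shows "0 \<le> block_matrix M11 M12 M21 M22"
  using assms by (auto simp: less_eq_vec_def block_matrix_def block_vector_def split: sum.split)

lemma block_vector_add: "block_vector u v + block_vector u' v' = block_vector (u + u') (v + v')"
  by (auto simp: vec_eq_iff block_vector_def split: sum.split)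

lemma block_vector_scaleR: "c *\<^sub>R block_vector u v = block_vector (c *\<^sub>R u) (c *\<^sub>R v)"
  by (auto simp: vec_eq_iff block_vector_def split: sum.split)

lemma block_vector_cases:
  obtains u v where "w = block_vector u v"
proof
  show "w = block_vector (\<chi> i. w $ Inl i) (\<chi> j. w $ Inr j)"
    by (auto simp: vec_eq_iff block_vector_def split: sum.split)
qed

lemma matrix_inv_mult:
  fixes M :: "'a::field^'n^'n"
  assumes "invertible M"
  shows "M ** matrix_inv M = mat 1" "matrix_inv M ** M = mat 1"
  using assms unfolding invertible_def matrix_inv_def by (auto intro: someI2_ex)

lemma symmetric_matrix_inv:
  fixes M :: "'a::field^'n^'n"
  assumes "invertible M" "transpose M = M"
  shows "transpose (matrix_inv M) = matrix_inv M"
proof -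
  have "transpose (matrix_inv M) ** M = mat 1"
    using arg_cong[OF matrix_inv_mult(1)[OF assms(1)], of transpose] assms(2)
    by (simp add: matrix_transpose_mul)
  then have "transpose (matrix_inv M) ** M ** matrix_inv M = matrix_inv M" by simp
  then show ?thesis
    by (metis matrix_inv_mult(1)[OF assms(1)] matrix_mul_assoc matrix_mul_rid)
qed

lemma invertible_sym_pos_def: "invertible W" if "sym_pos_def W"
proof -
  have "v = 0" if "W *v v = 0" for v
    using \<open>sym_pos_def W\<close> that by (force simp: sym_pos_def_def)
  then show ?thesis
    using matrix_left_invertible_ker[of W] by (simp add: invertible_left_inverse)
qed

lemma sym_pos_def_congruence:
  fixes A :: "real^'n^'m"
  assumes W: "sym_pos_def W" and A: "rank A = CARD('n)"
  shows "sym_pos_def (transpose A ** W ** A)"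
  unfolding sym_pos_def_def
proof (intro conjI allI impI)
  show "transpose (transpose A ** W ** A) = transpose A ** W ** A"
    using W by (simp add: sym_pos_def_def matrix_transpose_mul matrix_mul_assoc)
  fix v :: "real^'n" assume "v \<noteq> 0"
  with A have "A *v v \<noteq> 0"
    by (metis full_rank_injective inj_eq matrix_vector_mult_0_right)
  then have "0 < (A *v v) \<bullet> (W *v (A *v v))" using W by (simp add: sym_pos_def_def)
  also have "\<dots> = v \<bullet> (transpose A *v (W *v (A *v v)))"
    by (metis dot_lmul_matrix inner_commute transpose_matrix_vector)
  finally show "0 < v \<bullet> (transpose A ** W ** A *v v)"
    by (simp add: matrix_vector_mul_assoc matrix_mul_assoc del: transpose_matrix_vector)
qed

text \<open>
  Block elimination: the first row gives \<open>y = W (p - A s)\<close>, and the second row then becomes the normal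
  equations \<open>A\<^sup>T W A s = A\<^sup>T W p - q\<close>. The symmetry of \<open>W\<close> turns \<open>W A (A\<^sup>T W A)\<^sup>-\<^sup>1\<close> into the transpose
  of the weighted pseudoinverse, so that the blocks of the inverse take the form that occurs in
  \<^const>\<open>perturbation_matrix\<close>.
\<close>

lemma augmented_solution:
  fixes A :: "real^'n^'m"
  assumes W: "sym_pos_def W" and A: "rank A = CARD('n)"
    and sys: "augmented_matrix W A *v block_vector y s = block_vector p q"
  defines "G \<equiv> matrix_inv (transpose A ** W ** A)" and "P \<equiv> weighted_pinv W A"
  shows "y = (W - transpose P ** transpose A ** W) *v p + transpose P *v q"
    and "s = P *v p - G *v q"
proof -
  have top: "matrix_inv W *v y + A *v s = p" and bottom: "transpose A *v y = q"
    using sys by (simp_all add: augmented_matrix_def block_matrix_vector_mult block_vector_eq_iff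
        del: transpose_matrix_vector)
  have symW: "transpose W = W" using W by (simp add: sym_pos_def_def)
  have S: "invertible (transpose A ** W ** A)" "transpose (transpose A ** W ** A) = transpose A ** W ** A"
    using sym_pos_def_congruence[OF W A] invertible_sym_pos_def by (auto simp: sym_pos_def_def)
  have "W *v p = W *v (matrix_inv W *v y) + W *v (A *v s)"
    by (simp add: top[symmetric] matrix_vector_right_distrib)
  also have "W *v (matrix_inv W *v y) = y"
    by (simp add: matrix_vector_mul_assoc matrix_inv_mult(1)[OF invertible_sym_pos_def[OF W]])
  finally have y: "y = W *v p - W *v (A *v s)" by simp
  have "q = transpose A *v (W *v p) - (transpose A ** W ** A) *v s"
    by (simp add: bottom[symmetric] y matrix_vector_mult_diff_distrib matrix_vector_mul_assoc
        matrix_mul_assoc del: transpose_matrix_vector)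
  then have "transpose A *v (W *v p) = q + (transpose A ** W ** A) *v s" by simp
  then have "G *v (transpose A *v (W *v p)) = G *v q + (G ** (transpose A ** W ** A)) *v s"
    by (simp add: matrix_vector_right_distrib matrix_vector_mul_assoc del: transpose_matrix_vector)
  also have "G ** (transpose A ** W ** A) = mat 1"
    unfolding G_def by (rule matrix_inv_mult(2)[OF S(1)])
  also have "G *v (transpose A *v (W *v p)) = P *v p"
    by (simp add: G_def P_def weighted_pinv_def matrix_vector_mul_assoc matrix_mul_assoc
        del: transpose_matrix_vector)
  finally show s: "s = P *v p - G *v q" by simp
  have PT: "transpose P = W ** A ** G"
    using symmetric_matrix_inv[OF S] symW
    by (simp add: P_def G_def weighted_pinv_def matrix_transpose_mul matrix_mul_assoc)
  have "W ** A ** P = transpose P ** transpose A ** W"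
    unfolding PT by (simp add: P_def weighted_pinv_def G_def matrix_mul_assoc)
  then show "y = (W - transpose P ** transpose A ** W) *v p + transpose P *v q"
    by (subst y, simp add: s PT matrix_vector_mult_diff_distrib matrix_vector_mult_diff_rdistrib
        matrix_vector_mul_assoc matrix_mul_assoc del: transpose_matrix_vector)
qed

section \<open>Componentwise perturbation\<close>

lemma perturbation_matrix_nonneg: "0 \<le> perturbation_matrix W A"
  unfolding perturbation_matrix_def transpose_abs
  by (intro block_matrix_nonneg matrix_mult_nonneg abs_ge_zero)

text \<open>
  The vector obtained from the entrywise absolute value of the inverse of the augmented matrix, applied to
  \<open>(|b| + |A| |x|, |A|\<^sup>T |d|)\<close>; the upper block concerns the weighted residual, the lower block the solution.
\<close>

definition first_order_bound ::
  "real^'m^'m \<Rightarrow> real^'n^'m \<Rightarrow> real^'m \<Rightarrow> real^'m \<Rightarrow> real^'n \<Rightarrow> real^('m + 'n)" where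
  "first_order_bound W A b d x = block_vector
     (\<bar>W - transpose (weighted_pinv W A) ** transpose A ** W\<bar> *v (\<bar>b\<bar> + \<bar>A\<bar> *v \<bar>x\<bar>)
        + \<bar>transpose (weighted_pinv W A)\<bar> *v (transpose \<bar>A\<bar> *v \<bar>d\<bar>))
     (\<bar>weighted_pinv W A\<bar> *v (\<bar>b\<bar> + \<bar>A\<bar> *v \<bar>x\<bar>)
        + \<bar>matrix_inv (transpose A ** W ** A)\<bar> *v (transpose \<bar>A\<bar> *v \<bar>d\<bar>))"

text \<open>
  The perturbed solution appears on the right-hand side \<open>(p, q)\<close> of the system for \<open>(\<Delta>d, \<Delta>x)\<close>.
  Splitting \<open>|x + \<Delta>x| \<le> |x| + |\<Delta>x|\<close>, the part with \<open>x\<close> and \<open>d\<close> contributes the first-order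
  bound, while the part with \<open>\<Delta>x\<close> and \<open>\<Delta>d\<close> is multiplied by exactly the blocks of
  \<^const>\<open>perturbation_matrix\<close>. This is where that matrix comes from.
\<close>

lemma perturbation_inequality:
  fixes A :: "real^'n^'m"
  assumes W: "sym_pos_def W" and A: "rank A = CARD('n)"
    and sys: "augmented_matrix W A *v block_vector d x = block_vector b 0"
    and sys': "augmented_matrix W (A + \<Delta>A) *v block_vector (d + \<Delta>d) (x + \<Delta>x)
         = block_vector (b + \<Delta>b) 0"
    and \<Delta>A: "\<bar>\<Delta>A\<bar> \<le> \<epsilon> *\<^sub>R \<bar>A\<bar>" and \<Delta>b: "\<bar>\<Delta>b\<bar> \<le> \<epsilon> *\<^sub>R \<bar>b\<bar>"
  shows "block_vector \<bar>\<Delta>d\<bar> \<bar>\<Delta>x\<bar> \<le> \<epsilon> *\<^sub>R (first_order_bound W A b d x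
           + perturbation_matrix W A *v block_vector \<bar>\<Delta>d\<bar> \<bar>\<Delta>x\<bar>)"
proof -
  define p where "p = \<Delta>b - \<Delta>A *v (x + \<Delta>x)"
  define q where "q = - (transpose \<Delta>A *v (d + \<Delta>d))"
  have transpose_add: "transpose (A + \<Delta>A) = transpose A + transpose \<Delta>A"
    by (simp add: vec_eq_iff transpose_def)
  have top: "matrix_inv W *v d + A *v x = b" and bottom: "transpose A *v d = 0"
    using sys by (simp_all add: augmented_matrix_def block_matrix_vector_mult block_vector_eq_iff
        del: transpose_matrix_vector)
  have top': "matrix_inv W *v (d + \<Delta>d) + (A + \<Delta>A) *v (x + \<Delta>x) = b + \<Delta>b"
    and bottom': "(transpose A + transpose \<Delta>A) *v (d + \<Delta>d) = 0"
    using sys' by (simp_all add: augmented_matrix_def block_matrix_vector_mult block_vector_eq_iff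
        transpose_add del: transpose_matrix_vector)
  have "matrix_inv W *v \<Delta>d + A *v \<Delta>x = p"
    using top' unfolding top[symmetric] by (simp add: p_def algebra_simps)
  moreover have "transpose A *v \<Delta>d = q"
  proof -
    have "transpose A *v \<Delta>d + transpose \<Delta>A *v (d + \<Delta>d)
        = (transpose A + transpose \<Delta>A) *v (d + \<Delta>d) - transpose A *v d"
      by (simp add: matrix_vector_right_distrib matrix_vector_mult_add_rdistrib
          del: transpose_matrix_vector)
    then show ?thesis
      unfolding q_def bottom bottom' by (simp add: eq_neg_iff_add_eq_0 del: transpose_matrix_vector)
  qed
  ultimately have "augmented_matrix W A *v block_vector \<Delta>d \<Delta>x = block_vector p q"
    by (simp add: augmented_matrix_def block_matrix_vector_mult del: transpose_matrix_vector)
  note sol = augmented_solution[OF W A this]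

  have p: "\<bar>p\<bar> \<le> \<epsilon> *\<^sub>R (\<bar>b\<bar> + \<bar>A\<bar> *v \<bar>x\<bar> + \<bar>A\<bar> *v \<bar>\<Delta>x\<bar>)"
  proof -
    have "\<bar>p\<bar> \<le> \<bar>\<Delta>b\<bar> + \<bar>\<Delta>A *v (x + \<Delta>x)\<bar>" unfolding p_def by (rule abs_triangle_ineq4)
    also have "\<bar>\<Delta>A *v (x + \<Delta>x)\<bar> \<le> \<bar>\<Delta>A\<bar> *v (\<bar>x\<bar> + \<bar>\<Delta>x\<bar>)"
      by (intro abs_matrix_vector_bound abs_triangle_ineq)
    also have "\<dots> \<le> (\<epsilon> *\<^sub>R \<bar>A\<bar>) *v (\<bar>x\<bar> + \<bar>\<Delta>x\<bar>)"
      by (intro matrix_vector_mono_left \<Delta>A add_nonneg_nonneg abs_ge_zero)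
    finally show ?thesis
      using \<Delta>b by (simp add: matrix_vector_right_distrib scaleR_add_right add.assoc
          flip: scaleR_matrix_vector_assoc) (meson add_right_mono order_trans)
  qed
  have q: "\<bar>q\<bar> \<le> \<epsilon> *\<^sub>R (transpose \<bar>A\<bar> *v \<bar>d\<bar> + transpose \<bar>A\<bar> *v \<bar>\<Delta>d\<bar>)"
  proof -
    have "\<bar>q\<bar> = \<bar>transpose \<Delta>A *v (d + \<Delta>d)\<bar>" unfolding q_def by (rule abs_minus_cancel)
    also have "\<dots> \<le> \<bar>transpose \<Delta>A\<bar> *v (\<bar>d\<bar> + \<bar>\<Delta>d\<bar>)"
      by (intro abs_matrix_vector_bound abs_triangle_ineq)
    also have "\<dots> \<le> (\<epsilon> *\<^sub>R transpose \<bar>A\<bar>) *v (\<bar>d\<bar> + \<bar>\<Delta>d\<bar>)"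
    proof (intro matrix_vector_mono_left add_nonneg_nonneg abs_ge_zero)
      show "\<bar>transpose \<Delta>A\<bar> \<le> \<epsilon> *\<^sub>R transpose \<bar>A\<bar>"
        using \<Delta>A by (simp add: less_eq_vec_def transpose_def)
    qed
    finally show ?thesis
      by (simp add: matrix_vector_right_distrib scaleR_add_right del: transpose_matrix_vector
          flip: scaleR_matrix_vector_assoc)
  qed
  have combine: "\<bar>N *v p\<bar> + \<bar>N' *v q\<bar> \<le> \<epsilon> *\<^sub>R (\<bar>N\<bar> *v (\<bar>b\<bar> + \<bar>A\<bar> *v \<bar>x\<bar>)
      + \<bar>N'\<bar> *v (transpose \<bar>A\<bar> *v \<bar>d\<bar>)
      + ((\<bar>N'\<bar> ** transpose \<bar>A\<bar>) *v \<bar>\<Delta>d\<bar> + (\<bar>N\<bar> ** \<bar>A\<bar>) *v \<bar>\<Delta>x\<bar>))"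
    for N :: "real^'m^'k" and N' :: "real^'n^'k"
  proof -
    have "\<bar>N *v p\<bar> + \<bar>N' *v q\<bar> \<le> \<bar>N\<bar> *v (\<epsilon> *\<^sub>R (\<bar>b\<bar> + \<bar>A\<bar> *v \<bar>x\<bar> + \<bar>A\<bar> *v \<bar>\<Delta>x\<bar>))
        + \<bar>N'\<bar> *v (\<epsilon> *\<^sub>R (transpose \<bar>A\<bar> *v \<bar>d\<bar> + transpose \<bar>A\<bar> *v \<bar>\<Delta>d\<bar>))"
      by (intro add_mono abs_matrix_vector_bound p q)
    then show ?thesis
      by (simp add: matrix_vector_right_distrib matrix_vector_mult_scaleR scaleR_add_right add_ac
          flip: matrix_vector_mul_assoc del: transpose_matrix_vector)
  qed
  have "\<bar>\<Delta>d\<bar> \<le> \<bar>(W - transpose (weighted_pinv W A) ** transpose A ** W) *v p\<bar>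
      + \<bar>transpose (weighted_pinv W A) *v q\<bar>"
    by (subst sol(1)) (rule abs_triangle_ineq)
  moreover have "\<bar>\<Delta>x\<bar> \<le> \<bar>weighted_pinv W A *v p\<bar> + \<bar>matrix_inv (transpose A ** W ** A) *v q\<bar>"
    by (subst sol(2)) (rule abs_triangle_ineq4)
  ultimately show ?thesis
    unfolding first_order_bound_def perturbation_matrix_def block_matrix_vector_mult
      block_vector_add block_vector_scaleR block_vector_le_iff
    by (blast intro: order_trans combine)
qed

text \<open>
  The vector \<open>v\<close> must not depend on \<open>\<epsilon>\<close>. The rescaled \<open>y = z / \<epsilon>\<close> satisfies
  \<open>y \<le> g + \<epsilon> M y \<le> g + \<epsilon>\<^sub>0 M y\<close>, an inequality free of \<open>\<epsilon>\<close>, so one bound \<open>u\<close> serves for all \<open>\<epsilon> \<le> \<epsilon>\<^sub>0\<close> and \<open>v = M u\<close> will do.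
\<close>

lemma second_order_bound:
  fixes M :: "real^'n^'n"
  assumes M: "0 \<le> M" and \<epsilon>\<^sub>0: "0 < \<epsilon>\<^sub>0" "\<epsilon>\<^sub>0 < 1 / mat_spectral_radius M"
  shows "\<exists>v. \<forall>\<epsilon> z. 0 < \<epsilon> \<longrightarrow> \<epsilon> \<le> \<epsilon>\<^sub>0 \<longrightarrow> 0 \<le> z \<longrightarrow> z \<le> \<epsilon> *\<^sub>R (g + M *v z) \<longrightarrow>
    z \<le> \<epsilon> *\<^sub>R g + \<epsilon>\<^sup>2 *\<^sub>R v"
proof -
  obtain u where u: "\<And>z. z \<le> g + \<epsilon>\<^sub>0 *\<^sub>R (M *v z) \<Longrightarrow> z \<le> u"
    using subsolutions_bounded[OF M less_imp_le[OF \<epsilon>\<^sub>0(1)] \<epsilon>\<^sub>0(2), of g] by blast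
  have "z \<le> \<epsilon> *\<^sub>R g + \<epsilon>\<^sup>2 *\<^sub>R (M *v u)"
    if \<epsilon>: "0 < \<epsilon>" "\<epsilon> \<le> \<epsilon>\<^sub>0" and z: "0 \<le> z" "z \<le> \<epsilon> *\<^sub>R (g + M *v z)" for \<epsilon> z
  proof -
    define y where "y = (1 / \<epsilon>) *\<^sub>R z"
    have z_eq: "z = \<epsilon> *\<^sub>R y" using \<epsilon> by (simp add: y_def)
    have "y \<le> g + M *v z"
      using scaleR_left_mono[OF z(2), of "1 / \<epsilon>"] \<epsilon> by (simp add: y_def)
    also have "M *v z = \<epsilon> *\<^sub>R (M *v y)" by (simp add: z_eq matrix_vector_mult_scaleR)
    also have "\<dots> \<le> \<epsilon>\<^sub>0 *\<^sub>R (M *v y)"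
      using matrix_vector_mono[OF M, of 0 y] \<epsilon> z(1)
      by (intro scaleR_right_mono) (simp_all add: y_def scaleR_nonneg_nonneg)
    finally have "y \<le> u" by (intro u) simp
    then have "M *v y \<le> M *v u" by (rule matrix_vector_mono[OF M])
    then have "\<epsilon>\<^sup>2 *\<^sub>R (M *v y) \<le> \<epsilon>\<^sup>2 *\<^sub>R (M *v u)" by (rule scaleR_left_mono) simp
    moreover have "\<epsilon> *\<^sub>R (g + M *v z) = \<epsilon> *\<^sub>R g + \<epsilon>\<^sup>2 *\<^sub>R (M *v y)"
      by (simp add: z_eq matrix_vector_mult_scaleR scaleR_add_right power2_eq_square)
    ultimately show ?thesis using order_trans[OF z(2)] by simp
  qed
  then show ?thesis by blast
qed

lemma infnorm_le_of_second_order: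
  fixes y f g v :: "real^'n"
  assumes "\<bar>y\<bar> \<le> \<epsilon> *\<^sub>R (f + g) + \<epsilon>\<^sup>2 *\<^sub>R v" "0 \<le> \<epsilon>"
  shows "infnorm y \<le> \<epsilon> * (infnorm f + infnorm g) + \<epsilon>\<^sup>2 * infnorm v"
proof -
  have "infnorm y \<le> infnorm (\<epsilon> *\<^sub>R (f + g) + \<epsilon>\<^sup>2 *\<^sub>R v)"
    by (rule infnorm_mono_abs[OF assms(1)])
  also have "\<dots> \<le> \<epsilon> * infnorm (f + g) + \<epsilon>\<^sup>2 * infnorm v"
    using infnorm_triangle[of "\<epsilon> *\<^sub>R (f + g)" "\<epsilon>\<^sup>2 *\<^sub>R v"] assms(2) by (simp add: infnorm_mul)
  also have "\<epsilon> * infnorm (f + g) \<le> \<epsilon> * (infnorm f + infnorm g)"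
    using assms(2) by (intro mult_left_mono infnorm_triangle)
  finally show ?thesis by simp
qed

theorem theorem12:
  fixes A :: "real^'n^'m" and W :: "real^'m^'m"
    and b d :: "real^'m" and x :: "real^'n"
  assumes "CARD('n) \<le> CARD('m)"
    and "rank A = CARD('n)"
    and "sym_pos_def W"
    and "augmented_matrix W A *v block_vector d x = block_vector b 0"
  shows "\<exists>r\<^sub>x r\<^sub>d :: real \<Rightarrow> real.
    r\<^sub>x \<in> O[at_right 0](\<lambda>\<epsilon>. \<epsilon>\<^sup>2) \<and> r\<^sub>d \<in> O[at_right 0](\<lambda>\<epsilon>. \<epsilon>\<^sup>2) \<and>
    (\<forall>\<epsilon> (\<Delta>A :: real^'n^'m) (\<Delta>b :: real^'m) (\<Delta>d :: real^'m) (\<Delta>x :: real^'n).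
       0 < \<epsilon> \<longrightarrow> \<epsilon> < 1 / mat_spectral_radius (perturbation_matrix W A) \<longrightarrow>
       \<bar>\<Delta>A\<bar> \<le> \<epsilon> *\<^sub>R \<bar>A\<bar> \<longrightarrow> \<bar>\<Delta>b\<bar> \<le> \<epsilon> *\<^sub>R \<bar>b\<bar> \<longrightarrow>
       augmented_matrix W (A + \<Delta>A) *v block_vector (d + \<Delta>d) (x + \<Delta>x)
         = block_vector (b + \<Delta>b) 0 \<longrightarrow>
       infnorm \<Delta>x \<le>
         \<epsilon> * (infnorm (\<bar>weighted_pinv W A\<bar> *v (\<bar>b\<bar> + \<bar>A\<bar> *v \<bar>x\<bar>))
              + infnorm (\<bar>matrix_inv (transpose A ** W ** A)\<bar> *v (transpose \<bar>A\<bar> *v \<bar>d\<bar>)))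
         + r\<^sub>x \<epsilon> \<and>
       infnorm \<Delta>d \<le>
         \<epsilon> * (infnorm (\<bar>W - transpose (weighted_pinv W A) ** transpose A ** W\<bar>
                          *v (\<bar>b\<bar> + \<bar>A\<bar> *v \<bar>x\<bar>))
              + infnorm (\<bar>transpose (weighted_pinv W A)\<bar> *v (transpose \<bar>A\<bar> *v \<bar>d\<bar>)))
         + r\<^sub>d \<epsilon>)"
proof -
  define M where "M = perturbation_matrix W A"
  define \<rho> where "\<rho> = mat_spectral_radius M"
  define g where "g = first_order_bound W A b d x"
  have "\<exists>v w. \<forall>\<epsilon> z. 0 < \<epsilon> \<longrightarrow> \<epsilon> \<le> \<epsilon>\<^sub>0 \<longrightarrow> 0 \<le> z \<longrightarrow> z \<le> \<epsilon> *\<^sub>R (g + M *v z) \<longrightarrow>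
      z \<le> \<epsilon> *\<^sub>R g + \<epsilon>\<^sup>2 *\<^sub>R block_vector v w" if "0 < \<epsilon>\<^sub>0" "\<epsilon>\<^sub>0 < 1 / \<rho>" for \<epsilon>\<^sub>0
  proof -
    have "0 \<le> M" unfolding M_def by (rule perturbation_matrix_nonneg)
    from second_order_bound[OF this that[unfolded \<rho>_def], of g]
    obtain v where v: "\<forall>\<epsilon> z. 0 < \<epsilon> \<longrightarrow> \<epsilon> \<le> \<epsilon>\<^sub>0 \<longrightarrow> 0 \<le> z \<longrightarrow> z \<le> \<epsilon> *\<^sub>R (g + M *v z) \<longrightarrow>
        z \<le> \<epsilon> *\<^sub>R g + \<epsilon>\<^sup>2 *\<^sub>R v" ..
    obtain v1 v2 where "v = block_vector v1 v2" by (rule block_vector_cases)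
    with v show ?thesis by blast
  qed
  then obtain v w where vw: "\<And>\<epsilon>\<^sub>0 \<epsilon> z. 0 < \<epsilon>\<^sub>0 \<Longrightarrow> \<epsilon>\<^sub>0 < 1 / \<rho> \<Longrightarrow> 0 < \<epsilon> \<Longrightarrow> \<epsilon> \<le> \<epsilon>\<^sub>0 \<Longrightarrow> 0 \<le> z \<Longrightarrow>
      z \<le> \<epsilon> *\<^sub>R (g + M *v z) \<Longrightarrow> z \<le> \<epsilon> *\<^sub>R g + \<epsilon>\<^sup>2 *\<^sub>R block_vector (v \<epsilon>\<^sub>0) (w \<epsilon>\<^sub>0)"
    by metis
  \<comment> \<open>Using \<open>\<epsilon>\<^sub>0 = max \<epsilon> \<delta>\<close> gives a bound for every admissible \<open>\<epsilon>\<close>, with a coefficient of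
    \<open>\<epsilon>\<^sup>2\<close> that is constant for \<open>\<epsilon> \<le> \<delta>\<close>. The value 1 is a placeholder for the case in which
    no \<open>\<epsilon>\<close> is admissible.\<close>
  define \<delta> where "\<delta> = (if 0 < \<rho> then 1 / (2 * \<rho>) else 1)"
  have "0 < \<delta>" by (simp add: \<delta>_def)
  have \<delta>: "\<delta> < 1 / \<rho>" if "0 < \<epsilon>" "\<epsilon> < 1 / \<rho>" for \<epsilon>
  proof -
    have "0 < \<rho>" using that by (smt (verit) divide_nonneg_nonpos)
    then show ?thesis by (simp add: \<delta>_def field_simps)
  qed
  have remainder: "(\<lambda>\<epsilon>. \<epsilon>\<^sup>2 * c (max \<epsilon> \<delta>)) \<in> O[at_right 0](\<lambda>\<epsilon>. \<epsilon>\<^sup>2)" for c :: "real \<Rightarrow> real"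
  proof (rule bigoI[of _ "\<bar>c \<delta>\<bar>"])
    have "\<forall>\<^sub>F \<epsilon> in at_right 0. \<epsilon> < \<delta>"
      using \<open>0 < \<delta>\<close> by (auto simp: eventually_at_right[OF \<open>0 < \<delta>\<close>])
    then show "\<forall>\<^sub>F \<epsilon> in at_right 0. norm (\<epsilon>\<^sup>2 * c (max \<epsilon> \<delta>)) \<le> \<bar>c \<delta>\<bar> * norm (\<epsilon>\<^sup>2)"
      by (rule eventually_mono) (simp add: abs_mult max_def)
  qed
  show ?thesis
  proof (intro exI conjI allI impI)
    show "(\<lambda>\<epsilon>. \<epsilon>\<^sup>2 * infnorm (w (max \<epsilon> \<delta>))) \<in> O[at_right 0](\<lambda>\<epsilon>. \<epsilon>\<^sup>2)"
      and "(\<lambda>\<epsilon>. \<epsilon>\<^sup>2 * infnorm (v (max \<epsilon> \<delta>))) \<in> O[at_right 0](\<lambda>\<epsilon>. \<epsilon>\<^sup>2)"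
      by (rule remainder)+
    fix \<epsilon> :: real and \<Delta>A :: "real^'n^'m" and \<Delta>b \<Delta>d :: "real^'m" and \<Delta>x :: "real^'n"
    assume \<epsilon>: "0 < \<epsilon>" "\<epsilon> < 1 / mat_spectral_radius (perturbation_matrix W A)"
      and \<Delta>A: "\<bar>\<Delta>A\<bar> \<le> \<epsilon> *\<^sub>R \<bar>A\<bar>" and \<Delta>b: "\<bar>\<Delta>b\<bar> \<le> \<epsilon> *\<^sub>R \<bar>b\<bar>"
      and sys': "augmented_matrix W (A + \<Delta>A) *v block_vector (d + \<Delta>d) (x + \<Delta>x)
         = block_vector (b + \<Delta>b) 0"
    define z where "z = block_vector \<bar>\<Delta>d\<bar> \<bar>\<Delta>x\<bar>"
    have "z \<le> \<epsilon> *\<^sub>R (g + M *v z)"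
      unfolding z_def g_def M_def by (rule perturbation_inequality[OF assms(3,2,4) sys' \<Delta>A \<Delta>b])
    moreover have "0 \<le> z"
      by (auto simp: z_def less_eq_vec_def block_vector_def split: sum.split)
    moreover have "\<epsilon> < 1 / \<rho>" using \<epsilon>(2) by (simp add: \<rho>_def M_def)
    ultimately have z: "z \<le> \<epsilon> *\<^sub>R g + \<epsilon>\<^sup>2 *\<^sub>R block_vector (v (max \<epsilon> \<delta>)) (w (max \<epsilon> \<delta>))"
      using \<epsilon>(1) \<delta>[of \<epsilon>] by (intro vw) auto
    note bounds = z[unfolded z_def g_def first_order_bound_def block_vector_scaleR block_vector_add
        block_vector_le_iff]
    show "infnorm \<Delta>x \<le>
         \<epsilon> * (infnorm (\<bar>weighted_pinv W A\<bar> *v (\<bar>b\<bar> + \<bar>A\<bar> *v \<bar>x\<bar>))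
              + infnorm (\<bar>matrix_inv (transpose A ** W ** A)\<bar> *v (transpose \<bar>A\<bar> *v \<bar>d\<bar>)))
         + \<epsilon>\<^sup>2 * infnorm (w (max \<epsilon> \<delta>))"
      using infnorm_le_of_second_order[OF conjunct2[OF bounds]] \<epsilon>(1) by simp
    show "infnorm \<Delta>d \<le>
         \<epsilon> * (infnorm (\<bar>W - transpose (weighted_pinv W A) ** transpose A ** W\<bar>
                          *v (\<bar>b\<bar> + \<bar>A\<bar> *v \<bar>x\<bar>))
              + infnorm (\<bar>transpose (weighted_pinv W A)\<bar> *v (transpose \<bar>A\<bar> *v \<bar>d\<bar>)))
         + \<epsilon>\<^sup>2 * infnorm (v (max \<epsilon> \<delta>))"
      using infnorm_le_of_second_order[OF conjunct1[OF bounds]] \<epsilon>(1) by simp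
  qed
qed

end
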